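(* For real $h$ with $|h|<1$ define $$Y(h)=\iint_{0<u<v<1}\frac{\mathrm{d}u\,\mathrm{d}v}{\sqrt{uv(1-u)(1-v)(1-uh)(1-(1-v)h)}}.$$ Then in a neighbourhood of $h=0$ the function $Y$ satisfies $$\Bigl(\theta_h^3-\tfrac12h(2\theta_h+1)(2\theta_h^2+2\theta_h+1)+h^2(\theta_h+1)^3\Bigr)Y(h)=-\frac{(4-4h-h^2)h}{(2-h)^2\sqrt{1-h}},$$ where $\theta_h=h\,\frac{\mathrm{d}}{\mathrm{d}h}$ and powers of $h$ act as multiplication operators. *)

theory Defs
  imports "HOL-Analysis.Analysis"
begin

definition Y_integrand :: "real \<Rightarrow> real \<times> real \<Rightarrow> real" where
  "Y_integrand h p = (let u = fst p; v = snd p in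
     1 / sqrt (u * v * (1 - u) * (1 - v) * (1 - u * h) * (1 - (1 - v) * h)))"

definition Y_domain :: "(real \<times> real) set" where
  "Y_domain = {p. 0 < fst p \<and> fst p < snd p \<and> snd p < 1}"

definition Y :: "real \<Rightarrow> real" where
  "Y h = (LINT p:Y_domain|lborel. Y_integrand h p)"

definition theta :: "(real \<Rightarrow> real) \<Rightarrow> real \<Rightarrow> real" where
  "theta f = (\<lambda>h. h * deriv f h)"

end

theory Submission
  imports Defs
begin

text \<open>
  The substitution \<open>u = sin\<^sup>2 \<alpha>\<close>, \<open>v = cos\<^sup>2 \<beta>\<close> turns \<open>Y(h)\<close> into four times the integral of
  \<open>\<phi>(\<alpha>) \<phi>(\<beta>)\<close> over the triangle \<open>\<alpha> + \<beta> < \<pi>/2\<close>, where \<open>\<phi>(x) = (1 - h sin\<^sup>2 x)\<^bsup>-1/2\<^esup>\<close>. Equivalently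
  \<open>Y = 4 \<langle>\<Phi>, \<Phi>\<rangle>\<close> for the incomplete elliptic integral \<open>\<Phi>(x) = \<integral>\<^sub>0\<^sup>x \<phi>\<close> and the pairing
  \<open>\<langle>A, B\<rangle> = \<integral> A'(x) B(\<pi>/2 - x) dx\<close> over \<open>[0, \<pi>/2]\<close>, which is symmetric on functions vanishing at \<open>0\<close>.
  The function \<open>\<Phi>\<close> satisfies the Legendre equation in \<open>h\<close> up to the elementary term
  \<open>- sin x cos x (1 - h sin\<^sup>2 x)\<^bsup>-3/2\<^esup> / 4\<close>, and the operator of the theorem is the symmetric square
  of the Legendre operator; applied to \<open>\<langle>\<Phi>, \<Phi>\<rangle>\<close> it leaves only pairings of \<open>\<Phi>\<close> with elementary
  functions, which are elementary integrals.
\<close>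

section \<open>Elliptic integrand, incomplete elliptic integrals and their pairing\<close>

definition ell :: "real \<Rightarrow> real \<Rightarrow> real" where
  "ell h x = 1 / sqrt (1 - h * (sin x)\<^sup>2)"

text \<open>The \<open>k\<close>-th derivative of \<^const>\<open>ell\<close> with respect to the parameter \<open>h\<close>.\<close>

definition phi :: "nat \<Rightarrow> real \<Rightarrow> real \<Rightarrow> real" where
  "phi k h x = pochhammer (1/2) k * sin x ^ (2*k) * ell h x ^ (2*k+1)"

text \<open>For \<open>k = 0\<close> this is the incomplete elliptic integral of the first kind with
  parameter \<open>h\<close>, the squared modulus. Only \<open>x \<ge> 0\<close> is meaningful: for
  \<open>x < 0\<close> the interval is empty and the value is 0.\<close>

definition Phi :: "nat \<Rightarrow> real \<Rightarrow> real \<Rightarrow> real" where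
  "Phi k h x = integral {0..x} (phi k h)"

text \<open>The convolution of \<open>phi j h\<close> and \<open>Phi k h\<close> at
  \<open>pi/2\<close>, which is the integral of \<open>phi j h \<alpha> * phi k h \<beta>\<close>
  over the triangle \<open>\<alpha> + \<beta> < pi/2\<close>.\<close>

definition pairing :: "nat \<Rightarrow> nat \<Rightarrow> real \<Rightarrow> real" where
  "pairing j k h = integral {0..pi/2} (\<lambda>x. phi j h x * Phi k h (pi/2 - x))"

lemma has_integral_reflect_about:
  fixes f :: "real \<Rightarrow> real"
  assumes "(f has_integral I) {a..b}"
  shows "((\<lambda>x. f (c - x)) has_integral I) {c - b..c - a}"
  using has_integral_affinity[of f I a b "-1" c] assms by simp

section \<open>Differentiation and continuity of the integrands\<close>

lemma one_minus_mult_pos: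
  fixes h s :: real
  assumes "\<bar>h\<bar> < 1" "0 \<le> s" "s \<le> 1"
  shows "0 < 1 - h * s"
proof -
  have "\<bar>h * s\<bar> < 1"
    using assms mult_left_le[of s "\<bar>h\<bar>"] by (simp add: abs_mult)
  thus ?thesis by linarith
qed

lemma radicand_pos: "\<bar>h\<bar> < 1 \<Longrightarrow> 0 < 1 - h * (sin (x::real))\<^sup>2"
  by (intro one_minus_mult_pos) (auto simp: abs_square_le_1)

lemma ell_pos: "\<bar>h\<bar> < 1 \<Longrightarrow> 0 < ell h x"
  using radicand_pos[of h x] by (simp add: ell_def)

lemma ell_sq: "\<bar>h\<bar> < 1 \<Longrightarrow> (1 - h * (sin x)\<^sup>2) * (ell h x)\<^sup>2 = 1"
  using radicand_pos[of h x] by (simp add: ell_def power_divide)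

text \<open>The derivative is expressed by the cube of the function itself, so that all later
  derivatives are polynomials in \<open>ell\<close>, \<open>sin\<close> and
  \<open>cos\<close>.\<close>

lemma DERIV_inverse_sqrt:
  assumes "(f has_real_derivative f') (at x)" "0 < f x"
  shows "((\<lambda>x. 1 / sqrt (f x)) has_real_derivative - f' / 2 * (1 / sqrt (f x)) ^ 3) (at x)"
proof -
  have "((\<lambda>x. inverse (sqrt (f x))) has_real_derivative
          - (inverse (sqrt (f x)) * (inverse (sqrt (f x)) / 2 * f') * inverse (sqrt (f x)))) (at x)"
    using assms(2)
    by (intro DERIV_inverse' DERIV_chain2[OF DERIV_real_sqrt assms(1)]) auto
  moreover have "- (q * (q / 2 * f') * q) = - f' / 2 * q ^ 3" for q :: real
    by (simp add: power3_eq_cube)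
  ultimately show ?thesis
    by (simp only: inverse_eq_divide)
qed

lemma DERIV_ell_parameter:
  assumes "\<bar>h\<bar> < 1"
  shows "((\<lambda>h. ell h x) has_real_derivative (sin x)\<^sup>2 * ell h x ^ 3 / 2) (at h)"
proof -
  have "((\<lambda>h. 1 - h * (sin x)\<^sup>2) has_real_derivative - (sin x)\<^sup>2) (at h)"
    by (auto intro!: derivative_eq_intros)
  from DERIV_inverse_sqrt[OF this radicand_pos[OF assms]] show ?thesis
    by (simp add: ell_def)
qed

lemma DERIV_ell:
  assumes "\<bar>h\<bar> < 1"
  shows "(ell h has_real_derivative h * sin x * cos x * ell h x ^ 3) (at x)"
proof -
  have "((\<lambda>x. 1 - h * (sin x)\<^sup>2) has_real_derivative - 2 * h * sin x * cos x) (at x)"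
    by (auto intro!: derivative_eq_intros)
  from DERIV_inverse_sqrt[OF this radicand_pos[OF assms]] show ?thesis
    by (simp add: ell_def[abs_def] mult.assoc)
qed

lemma DERIV_phi_parameter:
  assumes "\<bar>h\<bar> < 1"
  shows "((\<lambda>h. phi k h x) has_real_derivative phi (Suc k) h x) (at h)"
  unfolding phi_def
  by (rule derivative_eq_intros refl DERIV_ell_parameter[OF assms])+
     (simp add: pochhammer_Suc power_add field_simps power2_eq_square power3_eq_cube)

text \<open>Parameter and argument vary together, which covers the joint continuity needed for
  differentiation under the integral sign.\<close>

lemma continuous_on_phi:
  assumes "continuous_on S f" "continuous_on S g" "\<And>y. y \<in> S \<Longrightarrow> \<bar>f y\<bar> < 1"
  shows "continuous_on S (\<lambda>y. phi k (f y) (g y))"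
proof -
  have "1 - f y * (sin (g y))\<^sup>2 \<noteq> 0" if "y \<in> S" for y
    using radicand_pos[OF assms(3)[OF that], of "g y"] by simp
  thus ?thesis
    unfolding phi_def ell_def
    by (intro continuous_intros assms(1,2)
          continuous_on_compose2[OF continuous_on_sin[OF continuous_on_id] assms(2)]) auto
qed

lemma phi_integrable: "\<bar>h\<bar> < 1 \<Longrightarrow> phi k h integrable_on {a..b}"
  by (intro integrable_continuous_real continuous_on_phi continuous_intros) auto

section \<open>Differentiation of \<open>Phi\<close> and of the pairing\<close>

lemma Phi_0 [simp]: "Phi k h 0 = 0"
  by (simp add: Phi_def)

text \<open>The derivative is one-sided at 0, since \<open>Phi k h\<close> is 0 to the left of 0
  while \<open>phi 0 h 0 = 1\<close>.\<close>

lemma DERIV_Phi_within: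
  assumes "\<bar>h\<bar> < 1" "x \<in> {0..b}"
  shows "(Phi k h has_real_derivative phi k h x) (at x within {0..b})"
  unfolding Phi_def
  by (rule integral_has_real_derivative[OF _ assms(2)])
     (use assms(1) in \<open>auto intro!: continuous_on_phi continuous_intros\<close>)

lemma DERIV_Phi_parameter:
  assumes "\<bar>h\<bar> < 1"
  shows "((\<lambda>h. Phi k h x) has_real_derivative Phi (Suc k) h x) (at h)"
proof -
  have "((\<lambda>h. integral (cbox 0 x) (phi k h)) has_real_derivative integral (cbox 0 x) (phi (Suc k) h))
          (at h within {-1<..<1})"
  proof (rule leibniz_rule_field_derivative)
    show "((\<lambda>h. phi k h t) has_real_derivative phi (Suc k) h t) (at h within {-1<..<1})"
      if "h \<in> {-1<..<1}" for h t
      using that by (intro has_field_derivative_at_within[OF DERIV_phi_parameter]) auto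
    show "phi k h integrable_on cbox 0 x" if "h \<in> {-1<..<1}" for h
      using that phi_integrable[of h] by auto
    show "continuous_on ({-1<..<1} \<times> cbox 0 x) (\<lambda>(h, t). phi (Suc k) h t)"
      unfolding split_beta by (intro continuous_on_phi continuous_intros) auto
  qed (use assms in auto)
  thus ?thesis
    using assms by (simp add: Phi_def at_within_open[of h "{-1<..<1}"] abs_less_iff)
qed

text \<open>Rescaling moves \<open>x\<close> from the limit of integration into the integrand; over
  a fixed interval, joint continuity in \<open>h\<close> and \<open>x\<close> follows from that of
  the integrand.\<close>

lemma Phi_eq_integral_unit:
  assumes "0 \<le> x"
  shows "Phi k h x = x * integral {0..1} (\<lambda>s. phi k h (s * x))"
proof (cases "x = 0")
  case False
  hence "x > 0" using assms by simp
  have "(\<lambda>y. y / x) ` {0..x} = {0..1}"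
    using \<open>x > 0\<close> by simp
  thus ?thesis
    using \<open>x > 0\<close> integral_stretch_real[of x 0 x "phi k h"]
    by (simp add: Phi_def mult.commute)
qed auto

lemma continuous_on_Phi:
  assumes f: "continuous_on S f" and g: "continuous_on S g"
    and "\<And>y. y \<in> S \<Longrightarrow> \<bar>f y\<bar> < 1" "\<And>y. y \<in> S \<Longrightarrow> 0 \<le> g y"
  shows "continuous_on S (\<lambda>y. Phi k (f y) (g y))"
proof -
  have "continuous_on S (\<lambda>y. integral (cbox 0 1) (\<lambda>s. phi k (f y) (s * g y)))"
  proof (rule integral_continuous_on_param)
    show "continuous_on (S \<times> cbox 0 1) (\<lambda>(y, s). phi k (f y) (s * g y))"
      unfolding split_beta
      by (intro continuous_on_phi continuous_intros continuous_on_compose2[OF f]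
            continuous_on_compose2[OF g]) (use assms(3) in auto)
  qed
  hence "continuous_on S (\<lambda>y. g y * integral {0..1} (\<lambda>s. phi k (f y) (s * g y)))"
    by (intro continuous_intros g) auto
  thus ?thesis
    by (rule continuous_on_eq) (use assms(4) Phi_eq_integral_unit in simp)
qed

lemma pairing_integrable:
  assumes "\<bar>h\<bar> < 1"
  shows "(\<lambda>x. phi j h x * Phi k h (pi/2 - x)) integrable_on {0..pi/2}"
  using assms by (intro integrable_continuous_real continuous_intros continuous_on_phi continuous_on_Phi) auto

lemma DERIV_pairing:
  assumes "\<bar>h\<bar> < 1"
  shows "(pairing j k has_real_derivative pairing (Suc j) k h + pairing j (Suc k) h) (at h)"
proof -
  let ?f = "\<lambda>j k h x. phi j h x * Phi k h (pi/2 - x)"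
  have "((\<lambda>h. integral (cbox 0 (pi/2)) (?f j k h)) has_real_derivative
          integral (cbox 0 (pi/2)) (\<lambda>x. ?f (Suc j) k h x + ?f j (Suc k) h x)) (at h within {-1<..<1})"
  proof (rule leibniz_rule_field_derivative)
    show "((\<lambda>h. ?f j k h t) has_real_derivative ?f (Suc j) k h t + ?f j (Suc k) h t) (at h within {-1<..<1})"
      if "h \<in> {-1<..<1}" for h t
      using that
      by (auto intro!: derivative_eq_intros has_field_derivative_at_within[OF DERIV_phi_parameter]
           has_field_derivative_at_within[OF DERIV_Phi_parameter])
    show "?f j k h integrable_on cbox 0 (pi/2)" if "h \<in> {-1<..<1}" for h
      using that pairing_integrable[of h] by auto
    show "continuous_on ({-1<..<1} \<times> cbox 0 (pi/2)) (\<lambda>(h, t). ?f (Suc j) k h t + ?f j (Suc k) h t)"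
      unfolding split_beta by (intro continuous_on_phi continuous_on_Phi continuous_intros) auto
  qed (use assms in auto)
  thus ?thesis
    using assms pairing_integrable[OF assms]
    by (simp add: pairing_def[abs_def] at_within_open[of h "{-1<..<1}"] integral_add abs_less_iff)
qed

text \<open>Integration by parts; the boundary terms vanish because \<^term>\<open>Phi k h 0 = 0\<close>.\<close>

lemma pairing_commute:
  assumes "\<bar>h\<bar> < 1"
  shows "pairing j k h = pairing k j h"
proof -
  let ?F = "\<lambda>x. Phi j h x * Phi k h (pi/2 - x)"
  let ?F' = "\<lambda>x. phi j h x * Phi k h (pi/2 - x) - phi k h (pi/2 - x) * Phi j h x"
  have "(?F has_real_derivative ?F' x) (at x within {0..pi/2})" if x: "x \<in> {0..pi/2}" for x
  proof -
    have "((\<lambda>x. Phi k h (pi/2 - x)) has_real_derivative phi k h (pi/2 - x) * (-1)) (at x within {0..pi/2})"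
      by (rule DERIV_image_chain[where f = "Phi k h" and g = "\<lambda>x. pi/2 - x", unfolded o_def])
         (use DERIV_Phi_within[OF assms, of "pi/2 - x" "pi/2" k] x in
           \<open>auto intro!: derivative_eq_intros\<close>)
    from DERIV_mult[OF DERIV_Phi_within[OF assms x, of j] this] show ?thesis
      by (simp add: algebra_simps)
  qed
  hence "(?F' has_integral (?F (pi/2) - ?F 0)) {0..pi/2}"
    by (intro fundamental_theorem_of_calculus)
       (auto simp flip: has_real_derivative_iff_has_vector_derivative)
  hence "(?F' has_integral 0) {0..pi/2}" by simp
  moreover have "((\<lambda>x. phi k h (pi/2 - x) * Phi j h x) has_integral pairing k j h) {0..pi/2}"
    using has_integral_reflect_about[OF integrable_integral[OF pairing_integrable[OF assms, of k j]], of "pi/2"]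
    by (simp add: pairing_def)
  moreover have "((\<lambda>x. phi j h x * Phi k h (pi/2 - x)) has_integral pairing j k h) {0..pi/2}"
    using pairing_integrable[OF assms] by (simp add: pairing_def integrable_integral)
  ultimately have "pairing j k h - pairing k j h = 0"
    by (intro has_integral_unique[OF has_integral_diff])
  thus ?thesis by simp
qed

section \<open>Inhomogeneous Legendre equation, pointwise and under the pairing\<close>

text \<open>Both sides vanish at 0 and have the same \<open>x\<close>-derivative. A differential
  equation in \<open>h\<close> for \<open>Phi\<close> thus reduces to an algebraic identity between
  the \<open>phi\<close>.\<close>

lemma Phi_combination_eq:
  assumes h: "\<bar>h\<bar> < 1" and x: "0 \<le> x" and "g 0 = 0"
    and g: "\<And>t. (g has_real_derivative a * phi i h t + b * phi j h t + c * phi k h t) (at t)"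
  shows "a * Phi i h x + b * Phi j h x + c * Phi k h x = g x"
proof -
  have "((\<lambda>t. a * phi i h t + b * phi j h t + c * phi k h t) has_integral g x - g 0) {0..x}"
    using g x
    by (intro fundamental_theorem_of_calculus)
       (auto simp flip: has_real_derivative_iff_has_vector_derivative intro: has_field_derivative_at_within)
  moreover have "((\<lambda>t. a * phi i h t + b * phi j h t + c * phi k h t) has_integral
      a * Phi i h x + b * Phi j h x + c * Phi k h x) {0..x}"
    unfolding Phi_def
    by (intro has_integral_add has_integral_mult_right integrable_integral phi_integrable h)
  ultimately have "a * Phi i h x + b * Phi j h x + c * Phi k h x = g x - g 0"
    by (rule has_integral_unique[rotated])
  thus ?thesis using \<open>g 0 = 0\<close> by simp
qed

lemma phi_simps:
  "phi 0 h x = ell h x"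
  "phi 1 h x = (sin x)\<^sup>2 * ell h x ^ 3 / 2"
  "phi 2 h x = 3/4 * sin x ^ 4 * ell h x ^ 5"
  "phi 3 h x = 15/8 * sin x ^ 6 * ell h x ^ 7"
  by (simp_all add: phi_def pochhammer_Suc numeral_eq_Suc)

text \<open>Used with \<open>q = ell h t\<close> and \<open>d = 1 - h * (sin t)^2\<close> to bring
  all terms to one common power of \<open>q\<close>; what remains is a polynomial identity.\<close>

lemma power_eq_mult_power_add:
  fixes d q :: real
  assumes "d * q\<^sup>2 = 1"
  shows "q ^ n = d * q ^ (n + 2)" "q ^ n = d\<^sup>2 * q ^ (n + 4)"
proof -
  have "d * q ^ (n + 2) = (d * q\<^sup>2) * q ^ n" "d\<^sup>2 * q ^ (n + 4) = (d * q\<^sup>2)\<^sup>2 * q ^ n"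
    by (simp_all add: numeral_eq_Suc mult_ac)
  thus "q ^ n = d * q ^ (n + 2)" "q ^ n = d\<^sup>2 * q ^ (n + 4)"
    by (simp_all only: assms power_one mult_1_left)
qed

text \<open>The left side is the Legendre operator that annihilates the complete integral;
  accordingly the right side vanishes at \<open>x = pi/2\<close>.\<close>

lemma Phi_ode:
  assumes h: "\<bar>h\<bar> < 1" and x: "0 \<le> x"
  shows "h * (1 - h) * Phi 2 h x + (1 - 2*h) * Phi 1 h x + (-1/4) * Phi 0 h x
    = - (1/4) * (sin x * cos x * ell h x ^ 3)"
proof (rule Phi_combination_eq[OF h x])
  fix t
  define q s c where "q = ell h t" and "s = sin t" and "c = cos t"
  have 1: "(1 - h * s\<^sup>2) * q\<^sup>2 = 1" and 2: "c\<^sup>2 = 1 - s\<^sup>2"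
    using ell_sq[OF h, of t] by (auto simp: q_def s_def c_def cos_squared_eq)
  have "((\<lambda>x. - (1/4) * (sin x * cos x * ell h x ^ 3)) has_real_derivative
      - (1/4) * ((c * c - s * s) * q^3 + s * c * (3 * q\<^sup>2 * (h * s * c * q^3)))) (at t)"
    unfolding q_def s_def c_def
    by (rule derivative_eq_intros DERIV_ell[OF h] refl)+ (simp add: algebra_simps)
  also have "- (1/4) * ((c * c - s * s) * q^3 + s * c * (3 * q\<^sup>2 * (h * s * c * q^3)))
      = h * (1 - h) * phi 2 h t + (1 - 2*h) * phi 1 h t + (-1/4) * phi 0 h t"
  proof -
    have q: "q ^ 3 = (1 - h * s\<^sup>2) * q ^ 5" "q = (1 - h * s\<^sup>2)\<^sup>2 * q ^ 5"
      using power_eq_mult_power_add[OF 1, of 3] power_eq_mult_power_add[OF 1, of 1] by simp_all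
    have "- (1/4) * ((c * c - s * s) * q^3 + s * c * (3 * q\<^sup>2 * (h * s * c * q^3)))
      = - (1/4) * ((c\<^sup>2 - s\<^sup>2) * q^3 + 3 * h * s\<^sup>2 * c\<^sup>2 * q^5)"
      by algebra
    also have "\<dots> = - (1/4) * ((c\<^sup>2 - s\<^sup>2) * ((1 - h * s\<^sup>2) * q ^ 5) + 3 * h * s\<^sup>2 * c\<^sup>2 * q^5)"
      by (simp only: q(1))
    also have "\<dots> = h * (1 - h) * (3/4 * s^4 * q^5) + (1 - 2*h) * (s\<^sup>2 * ((1 - h * s\<^sup>2) * q ^ 5) / 2)
        + (-1/4) * ((1 - h * s\<^sup>2)\<^sup>2 * q ^ 5)"
      unfolding 2 by algebra
    also have "\<dots> = h * (1 - h) * (3/4 * s^4 * q^5) + (1 - 2*h) * (s\<^sup>2 * q ^ 3 / 2) + (-1/4) * q"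
      by (simp only: q[symmetric])
    finally show ?thesis
      unfolding phi_simps q_def s_def .
  qed
  finally show "((\<lambda>x. - (1/4) * (sin x * cos x * ell h x ^ 3)) has_real_derivative
      h * (1 - h) * phi 2 h t + (1 - 2*h) * phi 1 h t + (-1/4) * phi 0 h t) (at t)" .
qed simp

text \<open>This is the \<open>h\<close>-derivative of \<open>Phi_ode\<close>, where
  \<open>-9/4 = -2 - 1/4\<close>. It is verified directly on the integrands in the same way.\<close>

lemma Phi_ode_deriv:
  assumes h: "\<bar>h\<bar> < 1" and x: "0 \<le> x"
  shows "h * (1 - h) * Phi 3 h x + 2 * (1 - 2*h) * Phi 2 h x + (-9/4) * Phi 1 h x
    = - (1/4) * (3/2 * (sin x ^ 3 * cos x * ell h x ^ 5))"
proof (rule Phi_combination_eq[OF h x])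
  fix t
  define q s c where "q = ell h t" and "s = sin t" and "c = cos t"
  have 1: "(1 - h * s\<^sup>2) * q\<^sup>2 = 1" and 2: "c\<^sup>2 = 1 - s\<^sup>2"
    using ell_sq[OF h, of t] by (auto simp: q_def s_def c_def cos_squared_eq)
  have "((\<lambda>x. - (1/4) * (3/2 * (sin x ^ 3 * cos x * ell h x ^ 5))) has_real_derivative
      - (3/8) * ((3 * s\<^sup>2 * c * c - s^3 * s) * q^5 + s^3 * c * (5 * q^4 * (h * s * c * q^3)))) (at t)"
    unfolding q_def s_def c_def
    by (rule derivative_eq_intros DERIV_ell[OF h] refl)+ (simp add: algebra_simps)
  also have "- (3/8) * ((3 * s\<^sup>2 * c * c - s^3 * s) * q^5 + s^3 * c * (5 * q^4 * (h * s * c * q^3)))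
      = h * (1 - h) * phi 3 h t + 2 * (1 - 2*h) * phi 2 h t + (-9/4) * phi 1 h t"
  proof -
    have q: "q ^ 5 = (1 - h * s\<^sup>2) * q ^ 7" "q ^ 3 = (1 - h * s\<^sup>2)\<^sup>2 * q ^ 7"
      using power_eq_mult_power_add[OF 1, of 5] power_eq_mult_power_add[OF 1, of 3] by simp_all
    have "- (3/8) * ((3 * s\<^sup>2 * c * c - s^3 * s) * q^5 + s^3 * c * (5 * q^4 * (h * s * c * q^3)))
      = - (3/8) * ((3 * s\<^sup>2 * c\<^sup>2 - s^4) * q^5 + 5 * h * s^4 * c\<^sup>2 * q^7)"
      by algebra
    also have "\<dots> = - (3/8) * ((3 * s\<^sup>2 * c\<^sup>2 - s^4) * ((1 - h * s\<^sup>2) * q ^ 7) + 5 * h * s^4 * c\<^sup>2 * q^7)"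
      by (simp only: q(1))
    also have "\<dots> = h * (1 - h) * (15/8 * s^6 * q^7) + 2 * (1 - 2*h) * (3/4 * s^4 * ((1 - h * s\<^sup>2) * q ^ 7))
        + (-9/4) * (s\<^sup>2 * ((1 - h * s\<^sup>2)\<^sup>2 * q ^ 7) / 2)"
      unfolding 2 by algebra
    also have "\<dots> = h * (1 - h) * (15/8 * s^6 * q^7) + 2 * (1 - 2*h) * (3/4 * s^4 * q ^ 5)
        + (-9/4) * (s\<^sup>2 * q ^ 3 / 2)"
      by (simp only: q[symmetric])
    finally show ?thesis
      unfolding phi_simps q_def s_def .
  qed
  finally show "((\<lambda>x. - (1/4) * (3/2 * (sin x ^ 3 * cos x * ell h x ^ 5))) has_real_derivative
      h * (1 - h) * phi 3 h t + 2 * (1 - 2*h) * phi 2 h t + (-9/4) * phi 1 h t) (at t)" .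
qed simp

text \<open>The equation is taken at \<open>pi/2 - x\<close>, multiplied by \<open>phi j h x\<close>
  and integrated.\<close>

lemma pairing_combination_eq:
  assumes h: "\<bar>h\<bar> < 1"
    and eq: "\<And>x. 0 \<le> x \<Longrightarrow> a * Phi i h x + b * Phi k h x + c * Phi l h x = g x"
    and I: "((\<lambda>x. phi j h x * g (pi/2 - x)) has_integral I) {0..pi/2}"
  shows "a * pairing j i h + b * pairing j k h + c * pairing j l h = I"
proof -
  have "((\<lambda>x. a * (phi j h x * Phi i h (pi/2 - x)) + b * (phi j h x * Phi k h (pi/2 - x))
          + c * (phi j h x * Phi l h (pi/2 - x)))
      has_integral a * pairing j i h + b * pairing j k h + c * pairing j l h) {0..pi/2}"
    unfolding pairing_def
    by (intro has_integral_add has_integral_mult_right integrable_integral pairing_integrable h)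
  moreover have "((\<lambda>x. a * (phi j h x * Phi i h (pi/2 - x)) + b * (phi j h x * Phi k h (pi/2 - x))
          + c * (phi j h x * Phi l h (pi/2 - x))) has_integral I) {0..pi/2}"
    by (rule has_integral_eq[OF _ I]) (simp flip: eq add: algebra_simps)
  ultimately show ?thesis
    by (rule has_integral_unique)
qed

section \<open>Closed forms of the boundary integrals\<close>

lemma DERIV_ell_reflect:
  assumes "\<bar>h\<bar> < 1"
  shows "((\<lambda>x. ell h (pi/2 - x)) has_real_derivative - (h * sin x * cos x * ell h (pi/2 - x) ^ 3)) (at x)"
proof -
  have "((\<lambda>x. ell h (pi/2 - x)) has_real_derivative
      (h * sin (pi/2 - x) * cos (pi/2 - x) * ell h (pi/2 - x) ^ 3) * (-1)) (at x)"
    by (rule DERIV_chain2[where g = "\<lambda>x. pi/2 - x", OF DERIV_ell[OF assms]])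
       (auto intro!: derivative_eq_intros)
  thus ?thesis by (simp add: sin_diff cos_diff mult_ac)
qed

lemma ell_endpoints: "ell h 0 = 1" "ell h (pi/2) = 1 / sqrt (1 - h)"
  by (simp_all add: ell_def)

text \<open>The constant \<open>K\<close> absorbs factors \<open>h\<close> and \<open>2 - h\<close>,
  so derivatives can be compared as polynomials. Division by \<open>K\<close> is the source of the
  assumption \<open>h \<noteq> 0\<close> below.\<close>

lemma has_integral_from_scaled_DERIV:
  fixes F f :: "real \<Rightarrow> real"
  assumes "a \<le> b" "K \<noteq> 0" "F b - F a = K * I" "\<And>x. (F has_real_derivative K * f x) (at x)"
  shows "(f has_integral I) {a..b}"
proof -
  have "((\<lambda>x. K * f x) has_integral F b - F a) {a..b}"
    using assms
    by (intro fundamental_theorem_of_calculus)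
       (auto simp flip: has_real_derivative_iff_has_vector_derivative intro: has_field_derivative_at_within)
  from has_integral_mult_right[OF this, of "inverse K"] show ?thesis
    using assms(2,3) by (simp flip: mult.assoc)
qed

text \<open>With \<open>a = 1 - h sin\<^sup>2 x\<close> and \<open>b = 1 - h cos\<^sup>2 x\<close>, the boundary integrands are
  algebraic in \<open>a\<close>, \<open>b = 2 - h - a\<close> and integrate to combinations of \<open>a\<^bsup>1/2\<^esup> b\<^bsup>-1/2\<^esup>\<close>,
  \<open>a\<^bsup>-1/2\<^esup> b\<^bsup>1/2\<^esup>\<close> and \<open>a\<^bsup>1/2\<^esup> b\<^bsup>-3/2\<^esup>\<close>, written below without division.\<close>

context
  fixes h :: real
  assumes h: "\<bar>h\<bar> < 1"
begin

lemma ell_reflect_facts: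
  "(1 - h * (sin x)\<^sup>2) * (ell h x)\<^sup>2 = 1"
  "(1 - h * (cos x)\<^sup>2) * (ell h (pi/2 - x))\<^sup>2 = 1"
  "(cos x)\<^sup>2 = 1 - (sin x)\<^sup>2"
  using ell_sq[of h x] ell_sq[of h "pi/2 - x"] h by (simp_all add: sin_diff cos_squared_eq)

lemma DERIV_boundary_terms:
  fixes x :: real
  defines "s \<equiv> sin x" and "c \<equiv> cos x" and "r \<equiv> ell h x" and "q \<equiv> ell h (pi/2 - x)"
  shows "((\<lambda>x. (1 - h * (sin x)\<^sup>2) * ell h x * ell h (pi/2 - x)) has_real_derivative
           - (h * (2 - h) * (s * c * r * q ^ 3))) (at x)" (is ?u0)
    and "((\<lambda>x. (1 - h * (cos x)\<^sup>2) * ell h x * ell h (pi/2 - x)) has_real_derivative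
           h * (2 - h) * (s * c * r ^ 3 * q)) (at x)" (is ?u1)
    and "((\<lambda>x. (1 - h * (sin x)\<^sup>2) * ell h x * ell h (pi/2 - x) ^ 3) has_real_derivative
           - (h * s * c * (3 * (2 - h) * (r * q ^ 5) - 2 * (r * q ^ 3)))) (at x)" (is ?u2)
proof -
  define a b where "a = 1 - h * s\<^sup>2" and "b = 1 - h * c\<^sup>2"
  have ab: "a * r\<^sup>2 = 1" "b * q\<^sup>2 = 1"
    using ell_reflect_facts(1,2)[of x] by (auto simp: a_def b_def s_def c_def r_def q_def)
  \<comment> \<open>The sum is constant in \<open>x\<close>; it produces the factor
    \<open>2 - h\<close> in all three derivatives.\<close>
  have sum: "a + b = 2 - h"
    using ell_reflect_facts(3)[of x] unfolding a_def b_def s_def c_def by algebra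
  have r: "DERIV (\<lambda>x. ell h x) x :> h * s * c * r ^ 3"
    and q: "DERIV (\<lambda>x. ell h (pi/2 - x)) x :> - (h * s * c * q ^ 3)"
    using DERIV_ell[OF h, of x] DERIV_ell_reflect[OF h, of x] by (simp_all add: s_def c_def r_def q_def)
  have sa: "DERIV (\<lambda>x. 1 - h * (sin x)\<^sup>2) x :> - (2 * h * s * c)"
    and sb: "DERIV (\<lambda>x. 1 - h * (cos x)\<^sup>2) x :> 2 * h * s * c"
    by (auto intro!: derivative_eq_intros simp: s_def c_def)
  have q3: "DERIV (\<lambda>x. ell h (pi/2 - x) ^ 3) x :> 3 * q\<^sup>2 * (- (h * s * c * q ^ 3))"
    using DERIV_power[OF q, of 3] by (simp add: q_def mult_ac)
  have ar: "a * r ^ 3 = r" and bq: "b * q ^ 3 = q" and bq5: "b * q ^ 5 = q ^ 3"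
    using ab by (simp_all add: numeral_eq_Suc mult.left_commute)
  have "(- (2 * h * s * c) * r + h * s * c * r ^ 3 * a) * q + - (h * s * c * q ^ 3) * (a * r)
      = h * s * c * ((a * r ^ 3) * q - 2 * r * q - a * (r * q ^ 3))"
    by algebra
  also have "\<dots> = - (h * s * c * (r * (b * q ^ 3) + a * (r * q ^ 3)))"
    unfolding ar bq by algebra
  also have "\<dots> = - (h * s * c * ((a + b) * (r * q ^ 3)))"
    by algebra
  finally have "(- (2 * h * s * c) * r + h * s * c * r ^ 3 * a) * q + - (h * s * c * q ^ 3) * (a * r)
      = - (h * (2 - h) * (s * c * r * q ^ 3))"
    unfolding sum by (simp add: mult_ac)
  thus ?u0
    by (intro DERIV_cong[OF DERIV_mult[OF DERIV_mult[OF sa r] q]])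
       (simp only: a_def b_def s_def c_def r_def q_def)
  have "((2 * h * s * c) * r + h * s * c * r ^ 3 * b) * q + - (h * s * c * q ^ 3) * (b * r)
      = h * s * c * (2 * r * q + b * (r ^ 3 * q) - (b * q ^ 3) * r)"
    by algebra
  also have "\<dots> = h * s * c * ((a * r ^ 3) * q + b * (r ^ 3 * q))"
    unfolding ar bq by algebra
  also have "\<dots> = h * s * c * ((a + b) * (r ^ 3 * q))"
    by algebra
  finally have "((2 * h * s * c) * r + h * s * c * r ^ 3 * b) * q + - (h * s * c * q ^ 3) * (b * r)
      = h * (2 - h) * (s * c * r ^ 3 * q)"
    unfolding sum by (simp add: mult_ac)
  thus ?u1
    by (intro DERIV_cong[OF DERIV_mult[OF DERIV_mult[OF sb r] q]])
       (simp only: a_def b_def s_def c_def r_def q_def)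
  have "(- (2 * h * s * c) * r + h * s * c * r ^ 3 * a) * q ^ 3 + 3 * q\<^sup>2 * (- (h * s * c * q ^ 3)) * (a * r)
      = - (h * s * c * (2 * r * q ^ 3 - (a * r ^ 3) * q ^ 3 + 3 * (a + b) * (r * q ^ 5) - 3 * r * (b * q ^ 5)))"
    by algebra
  also have "\<dots> = - (h * s * c * (3 * (2 - h) * (r * q ^ 5) - 2 * (r * q ^ 3)))"
    unfolding ar bq5 sum by algebra
  finally have "(- (2 * h * s * c) * r + h * s * c * r ^ 3 * a) * q ^ 3 + 3 * q\<^sup>2 * (- (h * s * c * q ^ 3)) * (a * r)
      = - (h * s * c * (3 * (2 - h) * (r * q ^ 5) - 2 * (r * q ^ 3)))" .
  thus ?u2
    by (intro DERIV_cong[OF DERIV_mult[OF DERIV_mult[OF sa r] q3]])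
       (simp only: a_def b_def s_def c_def r_def q_def)
qed

lemma sqrt_factor: "(1 - h) * (1 / sqrt (1 - h))\<^sup>2 = 1"
  using h by (simp add: power_divide)

lemma one_minus_two_minus_nonzero: "1 - h \<noteq> 0" "2 - h \<noteq> 0" "sqrt (1 - h) \<noteq> 0"
  using h by auto

lemma boundary_integral_0:
  assumes "h \<noteq> 0"
  shows "((\<lambda>x. sin x * cos x * ell h x * ell h (pi/2 - x) ^ 3) has_integral
    1 / sqrt (1 - h) / (2 - h)) {0..pi/2}"
proof (rule has_integral_from_scaled_DERIV[where K = "- (h * (2 - h))"])
  show "((\<lambda>x. (1 - h * (sin x)\<^sup>2) * ell h x * ell h (pi/2 - x)) has_real_derivative
      - (h * (2 - h)) * (sin x * cos x * ell h x * ell h (pi/2 - x) ^ 3)) (at x)" for x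
    using DERIV_boundary_terms(1)[of x] by simp
  show "(1 - h * (sin (pi/2))\<^sup>2) * ell h (pi/2) * ell h (pi/2 - pi/2) -
      (1 - h * (sin 0)\<^sup>2) * ell h 0 * ell h (pi/2 - 0) = - (h * (2 - h)) * (1 / sqrt (1 - h) / (2 - h))"
    using one_minus_two_minus_nonzero by (simp add: ell_endpoints field_simps)
qed (use assms h in auto)

lemma boundary_integral_1:
  assumes "h \<noteq> 0"
  shows "((\<lambda>x. sin x ^ 3 * cos x * ell h x ^ 3 * ell h (pi/2 - x) ^ 3) has_integral
    1 / sqrt (1 - h) / (2 - h)\<^sup>2) {0..pi/2}"
proof (rule has_integral_from_scaled_DERIV[where K = "h\<^sup>2 * (2 - h)\<^sup>2"])
  \<comment> \<open>With \<open>a\<close>, \<open>b\<close> as above, the weight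
    \<open>1 - h\<close> cancels the constant term:
    \<open>b - (1 - h) * a = h * (2 - h) * (sin x)^2\<close>, which supplies the extra
    \<open>(sin x)^2\<close>.\<close>
  let ?F = "\<lambda>x. (1 - h * (cos x)\<^sup>2) * ell h x * ell h (pi/2 - x)
       + (1 - h) * ((1 - h * (sin x)\<^sup>2) * ell h x * ell h (pi/2 - x))"
  show "(?F has_real_derivative
      h\<^sup>2 * (2 - h)\<^sup>2 * (sin x ^ 3 * cos x * ell h x ^ 3 * ell h (pi/2 - x) ^ 3)) (at x)" for x
  proof -
    define s c r q where "s = sin x" and "c = cos x" and "r = ell h x" and "q = ell h (pi/2 - x)"
    note facts = ell_reflect_facts[of x, folded s_def c_def r_def q_def]
    have r: "r = (1 - h * s\<^sup>2) * r ^ 3" and q: "q = (1 - h * c\<^sup>2) * q ^ 3"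
      using power_eq_mult_power_add(1)[OF facts(1), of 1] power_eq_mult_power_add(1)[OF facts(2), of 1]
      by (simp_all only: power_one_right one_plus_numeral add_num_simps)
    have "h * (2 - h) * (s * c * r ^ 3 * q) + (1 - h) * - (h * (2 - h) * (s * c * r * q ^ 3))
      = h * (2 - h) * (s * c * r ^ 3 * ((1 - h * c\<^sup>2) * q ^ 3))
        + (1 - h) * - (h * (2 - h) * (s * c * ((1 - h * s\<^sup>2) * r ^ 3) * q ^ 3))"
      by (simp only: r[symmetric] q[symmetric])
    also have "\<dots> = h\<^sup>2 * (2 - h)\<^sup>2 * (s ^ 3 * c * r ^ 3 * q ^ 3)"
      unfolding facts(3) by algebra
    finally show ?thesis
      unfolding s_def c_def r_def q_def
      by (intro DERIV_cong[OF DERIV_add[OF DERIV_boundary_terms(2) DERIV_cmult[OF DERIV_boundary_terms(1)]]])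
  qed
  have "?F (pi/2) - ?F 0 = h\<^sup>2 * ell h (pi/2)"
    by (simp add: ell_endpoints(1) algebra_simps power2_eq_square)
  thus "?F (pi/2) - ?F 0 = h\<^sup>2 * (2 - h)\<^sup>2 * (1 / sqrt (1 - h) / (2 - h)\<^sup>2)"
    using one_minus_two_minus_nonzero by (simp add: ell_endpoints(2))
qed (use assms h in auto)

lemma boundary_integral_2:
  assumes "h \<noteq> 0"
  shows "((\<lambda>x. sin x * cos x ^ 3 * ell h x * ell h (pi/2 - x) ^ 5) has_integral
    (3 - 2*h) / (1 - h) * (1 / sqrt (1 - h)) / (3 * (2 - h)\<^sup>2)) {0..pi/2}"
proof (rule has_integral_from_scaled_DERIV[where K = "3 * h\<^sup>2 * (2 - h)\<^sup>2"])
  \<comment> \<open>With \<open>q = ell h (pi/2 - x)\<close>, these weights make the derivative a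
    multiple of \<open>q^5 - q^3\<close>, and \<open>q^5 - q^3 = h * (cos x)^2 * q^5\<close>
    supplies the extra \<open>(cos x)^2\<close>.\<close>
  let ?F = "\<lambda>x. (4 - 3 * h) * ((1 - h * (sin x)\<^sup>2) * ell h x * ell h (pi/2 - x))
       - (2 - h) * ((1 - h * (sin x)\<^sup>2) * ell h x * ell h (pi/2 - x) ^ 3)"
  show "(?F has_real_derivative
      3 * h\<^sup>2 * (2 - h)\<^sup>2 * (sin x * cos x ^ 3 * ell h x * ell h (pi/2 - x) ^ 5)) (at x)" for x
  proof -
    define s c r q where "s = sin x" and "c = cos x" and "r = ell h x" and "q = ell h (pi/2 - x)"
    note facts = ell_reflect_facts[of x, folded s_def c_def r_def q_def]
    have q: "q ^ 3 = (1 - h * c\<^sup>2) * q ^ 5"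
      using power_eq_mult_power_add(1)[OF facts(2), of 3] by simp
    have "(4 - 3 * h) * - (h * (2 - h) * (s * c * r * q ^ 3))
        - (2 - h) * - (h * s * c * (3 * (2 - h) * (r * q ^ 5) - 2 * (r * q ^ 3)))
      = (4 - 3 * h) * - (h * (2 - h) * (s * c * r * ((1 - h * c\<^sup>2) * q ^ 5)))
        - (2 - h) * - (h * s * c * (3 * (2 - h) * (r * q ^ 5) - 2 * (r * ((1 - h * c\<^sup>2) * q ^ 5))))"
      by (simp only: q[symmetric])
    also have "\<dots> = 3 * h\<^sup>2 * (2 - h)\<^sup>2 * (s * c ^ 3 * r * q ^ 5)"
      by algebra
    finally show ?thesis
      unfolding s_def c_def r_def q_def
      by (intro DERIV_cong[OF DERIV_diff[OF DERIV_cmult[OF DERIV_boundary_terms(1)]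
            DERIV_cmult[OF DERIV_boundary_terms(3)]]])
  qed
  define z where "z = 1 / sqrt (1 - h)"
  have "z ^ 3 * (1 - h) = z"
    using sqrt_factor unfolding z_def[symmetric] by algebra
  hence z: "z ^ 3 = z / (1 - h)"
    using one_minus_two_minus_nonzero(1) by (simp only: eq_divide_eq) simp
  have "?F (pi/2) - ?F 0 = (4 - 3*h) * ((1 - h) * z) - (2 - h) * ((1 - h) * z)
      - ((4 - 3*h) * z - (2 - h) * z ^ 3)"
    by (simp add: ell_endpoints z_def[symmetric] algebra_simps)
  also have "\<dots> = 3 * h\<^sup>2 * (2 - h)\<^sup>2 * ((3 - 2*h) / (1 - h) * z / (3 * (2 - h)\<^sup>2))"
    unfolding z using one_minus_two_minus_nonzero(1,2) by (simp add: field_simps) algebra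
  finally show "?F (pi/2) - ?F 0 = 3 * h\<^sup>2 * (2 - h)\<^sup>2 *
      ((3 - 2*h) / (1 - h) * (1 / sqrt (1 - h)) / (3 * (2 - h)\<^sup>2))"
    by (simp add: z_def)
qed (use assms h in auto)

text \<open>\<open>Phi_ode\<close> is paired with \<open>phi 0\<close> and \<open>phi 1\<close>, and
  \<open>Phi_ode_deriv\<close> with \<open>phi 0\<close>. Reflection swaps \<open>sin\<close> and
  \<open>cos\<close> in the elementary terms, giving the three boundary integrals.\<close>

lemma pairing_ode:
  assumes "h \<noteq> 0"
  defines "z \<equiv> 1 / sqrt (1 - h)"
  shows "h * (1 - h) * pairing 0 2 h + (1 - 2*h) * pairing 0 1 h + (-1/4) * pairing 0 0 h
      = - (1/4) * (z / (2 - h))"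
    and "h * (1 - h) * pairing 1 2 h + (1 - 2*h) * pairing 1 1 h + (-1/4) * pairing 1 0 h
      = - (1/8) * (z / (2 - h)\<^sup>2)"
    and "h * (1 - h) * pairing 0 3 h + 2 * (1 - 2*h) * pairing 0 2 h + (-9/4) * pairing 0 1 h
      = - (3/8) * ((3 - 2*h) / (1 - h) * z / (3 * (2 - h)\<^sup>2))"
proof -
  show "h * (1 - h) * pairing 0 2 h + (1 - 2*h) * pairing 0 1 h + (-1/4) * pairing 0 0 h
      = - (1/4) * (z / (2 - h))"
  proof (rule pairing_combination_eq[OF h Phi_ode[OF h]])
    show "((\<lambda>x. phi 0 h x * (- (1/4) * (sin (pi/2 - x) * cos (pi/2 - x) * ell h (pi/2 - x) ^ 3)))
        has_integral - (1/4) * (z / (2 - h))) {0..pi/2}"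
      unfolding z_def
      by (rule has_integral_eq[OF _ has_integral_mult_right[OF boundary_integral_0[OF assms(1)]]])
         (simp add: phi_simps sin_diff cos_diff)
  qed
  show "h * (1 - h) * pairing 1 2 h + (1 - 2*h) * pairing 1 1 h + (-1/4) * pairing 1 0 h
      = - (1/8) * (z / (2 - h)\<^sup>2)"
  proof (rule pairing_combination_eq[OF h Phi_ode[OF h]])
    show "((\<lambda>x. phi 1 h x * (- (1/4) * (sin (pi/2 - x) * cos (pi/2 - x) * ell h (pi/2 - x) ^ 3)))
        has_integral - (1/8) * (z / (2 - h)\<^sup>2)) {0..pi/2}"
      unfolding z_def phi_simps
      by (rule has_integral_eq[OF _ has_integral_mult_right[OF boundary_integral_1[OF assms(1)]]])
         (simp add: sin_diff cos_diff power2_eq_square power3_eq_cube)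
  qed
  show "h * (1 - h) * pairing 0 3 h + 2 * (1 - 2*h) * pairing 0 2 h + (-9/4) * pairing 0 1 h
      = - (3/8) * ((3 - 2*h) / (1 - h) * z / (3 * (2 - h)\<^sup>2))"
  proof (rule pairing_combination_eq[OF h Phi_ode_deriv[OF h]])
    show "((\<lambda>x. phi 0 h x * (- (1/4) * (3/2 * (sin (pi/2 - x) ^ 3 * cos (pi/2 - x) * ell h (pi/2 - x) ^ 5))))
        has_integral - (3/8) * ((3 - 2*h) / (1 - h) * z / (3 * (2 - h)\<^sup>2))) {0..pi/2}"
      unfolding z_def
      by (rule has_integral_eq[OF _ has_integral_mult_right[OF boundary_integral_2[OF assms(1)]]])
         (simp add: phi_simps sin_diff cos_diff)
  qed
qed

end

section \<open>Reduction of the double integral to the pairing\<close>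

text \<open>Here \<open>v = (sin t)^2\<close>, so \<open>\<beta> = pi/2 - t\<close> and
  \<open>1 - (1 - v) * h\<close> becomes \<open>1 - h * (sin \<beta>)^2\<close>. The denominator is
  cancelled by the Jacobians of the two substitutions.\<close>

lemma Y_integrand_sin:
  assumes x: "x \<in> {0<..<pi/2}" and t: "t \<in> {0<..<pi/2}"
  shows "Y_integrand h ((sin x)\<^sup>2, (sin t)\<^sup>2)
    = ell h x * ell h (pi/2 - t) / (sin x * cos x * sin t * cos t)"
proof -
  have pos: "0 < sin x" "0 < cos x" "0 < sin t" "0 < cos t"
    using x t by (auto intro: sin_gt_zero2 cos_gt_zero)
  have "1 - (sin y)\<^sup>2 = (cos y)\<^sup>2" for y :: real
    by (simp add: cos_squared_eq)
  thus ?thesis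
    using pos
    by (simp add: Y_integrand_def Let_def ell_def sin_diff real_sqrt_mult mult.commute[of h])
qed

lemma sin_squared_less:
  assumes "0 \<le> x" "x < t" "t \<le> pi/2"
  shows "(sin x)\<^sup>2 < (sin t)\<^sup>2"
  using assms by (intro power_strict_mono sin_monotone_2pi sin_ge_zero) auto

lemma sin_squared_in_Y_domain:
  assumes "0 < x" "x < t" "t < pi/2"
  shows "((sin x)\<^sup>2, (sin t)\<^sup>2) \<in> Y_domain"
  using sin_squared_less[of 0 x] sin_squared_less[of x t] sin_squared_less[of t "pi/2"] assms
  by (simp add: Y_domain_def)

text \<open>The lower limit \<open>a\<close> is free so that the inner integral can start at
  \<open>v = u\<close>. With nonnegative integrals the endpoint singularities need no separate
  integrability argument.\<close>

lemma nn_integral_sin_substitution: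
  fixes f :: "real \<Rightarrow> ennreal"
  assumes "f \<in> borel_measurable borel" "0 \<le> a" "a < pi/2"
    and "\<And>y. y \<notin> {(sin a)\<^sup>2..1} \<Longrightarrow> f y = 0"
  shows "(\<integral>\<^sup>+y. f y \<partial>lborel) = (\<integral>\<^sup>+x\<in>{a..pi/2}. f ((sin x)\<^sup>2) * ennreal (2 * sin x * cos x) \<partial>lborel)"
proof -
  have "(\<integral>\<^sup>+y. f y \<partial>lborel) = (\<integral>\<^sup>+y\<in>{(sin a)\<^sup>2..(sin (pi/2))\<^sup>2}. f y \<partial>lborel)"
    using assms(4) by (intro nn_integral_cong) (auto simp: indicator_def)
  also have "\<dots> = (\<integral>\<^sup>+x\<in>{a..pi/2}. f ((sin x)\<^sup>2) * ennreal (2 * sin x * cos x) \<partial>lborel)"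
    using assms(1-3)
    by (intro nn_integral_substitution_aux)
       (auto intro!: derivative_eq_intros continuous_intros mult_nonneg_nonneg sin_ge_zero cos_ge_zero)
  finally show ?thesis .
qed

text \<open>Tonelli's theorem splits the double integral; the sine substitution is applied first to
  \<open>v\<close> with \<open>u\<close> fixed, then to \<open>u\<close>.\<close>

lemma Y_eq_pairing:
  assumes h: "\<bar>h\<bar> < 1"
  shows "Y h = 4 * pairing 0 0 h"
proof -
  define J where "J p = indicator Y_domain p * Y_integrand h p" for p
  have dom: "Y_domain \<in> sets borel"
    unfolding Y_domain_def
    by (intro borel_open open_Collect_conj open_Collect_less continuous_intros)
  have [measurable]: "Y_integrand h \<in> borel_measurable borel"
    unfolding Y_integrand_def Let_def by (subst borel_prod[symmetric]) measurable
  have J [measurable]: "J \<in> borel_measurable borel"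
    unfolding J_def[abs_def] using dom by measurable
  have J_nonneg: "0 \<le> J p" for p
  proof (cases "p \<in> Y_domain")
    case True
    thus ?thesis
      using one_minus_mult_pos[OF h, of "fst p"] one_minus_mult_pos[OF h, of "1 - snd p"]
      by (auto simp: J_def Y_integrand_def Let_def Y_domain_def mult.commute[of h]
               intro!: divide_nonneg_nonneg real_sqrt_ge_zero mult_nonneg_nonneg)
  qed (simp add: J_def)
  define G where "G u = (\<integral>\<^sup>+v. ennreal (J (u, v)) \<partial>lborel)" for u
  have G [measurable]: "G \<in> borel_measurable borel"
    unfolding G_def[abs_def] by measurable
  have Phi_nonneg: "0 \<le> Phi 0 h x" for x
    unfolding Phi_def using ell_pos[OF h] phi_integrable[OF h]
    by (intro integral_nonneg) (auto simp: phi_simps less_imp_le)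
  \<comment> \<open>The inner integral together with the Jacobian of the outer substitution; each
    Jacobian contributes a factor 2 to the 4.\<close>
  have G_eq: "G ((sin x)\<^sup>2) * ennreal (2 * sin x * cos x) = ennreal (4 * (phi 0 h x * Phi 0 h (pi/2 - x)))"
    if x: "x \<in> {0<..<pi/2}" for x
  proof -
    have pos: "0 < sin x" "0 < cos x"
      using x by (auto intro: sin_gt_zero2 cos_gt_zero)
    let ?c = "2 * ell h x / (sin x * cos x)"
    have c: "0 \<le> ?c" using pos ell_pos[OF h, of x] by simp
    have "G ((sin x)\<^sup>2) = (\<integral>\<^sup>+t\<in>{x..pi/2}. ennreal (J ((sin x)\<^sup>2, (sin t)\<^sup>2)) * ennreal (2 * sin t * cos t) \<partial>lborel)"
      unfolding G_def using x
      by (intro nn_integral_sin_substitution) (auto simp: J_def Y_domain_def indicator_def)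
    also have "\<dots> = (\<integral>\<^sup>+t\<in>{x..pi/2}. ennreal (?c * phi 0 h (pi/2 - t)) \<partial>lborel)"
    proof (rule nn_integral_cong_AE)
      have *: "ennreal (J ((sin x)\<^sup>2, (sin t)\<^sup>2)) * ennreal (2 * sin t * cos t) = ennreal (?c * phi 0 h (pi/2 - t))"
        if t: "t \<in> {x<..<pi/2}" for t
      proof -
        have "0 < sin t" "0 < cos t"
          using x t by (auto intro: sin_gt_zero2 cos_gt_zero)
        moreover have "J ((sin x)\<^sup>2, (sin t)\<^sup>2) = ell h x * ell h (pi/2 - t) / (sin x * cos x * sin t * cos t)"
          using sin_squared_in_Y_domain[of x t] Y_integrand_sin[of x t h] x t by (simp add: J_def)
        ultimately have "J ((sin x)\<^sup>2, (sin t)\<^sup>2) * (2 * sin t * cos t) = ?c * phi 0 h (pi/2 - t)"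
          by (simp add: phi_simps)
        thus ?thesis
          using J_nonneg by (simp only: flip: ennreal_mult')
      qed
      \<comment> \<open>At both endpoints the left integrand is 0 while the right one is positive,
        so the two agree only almost everywhere.\<close>
      have "AE t in lborel. t \<noteq> x \<and> t \<noteq> pi/2"
        using AE_lborel_singleton[of x] AE_lborel_singleton[of "pi/2"] by eventually_elim simp
      thus "AE t in lborel. ennreal (J ((sin x)\<^sup>2, (sin t)\<^sup>2)) * ennreal (2 * sin t * cos t) * indicator {x..pi/2} t
          = ennreal (?c * phi 0 h (pi/2 - t)) * indicator {x..pi/2} t"
        by eventually_elim (use * in \<open>auto simp: indicator_def\<close>)
    qed
    also have "\<dots> = ennreal (?c * Phi 0 h (pi/2 - x))"
    proof (rule nn_integral_has_integral_lebesgue')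
      show "0 \<le> ?c * phi 0 h (pi/2 - t)" for t
        using ell_pos[OF h, of "pi/2 - t"] unfolding phi_simps by (intro mult_nonneg_nonneg c) simp
      show "((\<lambda>t. ?c * phi 0 h (pi/2 - t)) has_integral ?c * Phi 0 h (pi/2 - x)) {x..pi/2}"
        using has_integral_reflect_about
          [OF integrable_integral[OF phi_integrable[OF h, of 0 0 "pi/2 - x"]], of "pi/2"]
        by (intro has_integral_mult_right) (simp add: Phi_def)
    qed
    finally have "G ((sin x)\<^sup>2) * ennreal (2 * sin x * cos x)
        = ennreal (?c * Phi 0 h (pi/2 - x) * (2 * sin x * cos x))"
      using mult_nonneg_nonneg[OF c Phi_nonneg] by (simp only: ennreal_mult')
    also have "?c * Phi 0 h (pi/2 - x) * (2 * sin x * cos x) = 4 * (phi 0 h x * Phi 0 h (pi/2 - x))"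
      using pos by (simp add: phi_simps)
    finally show ?thesis .
  qed
  have "(\<integral>\<^sup>+p. ennreal (J p) \<partial>lborel) = (\<integral>\<^sup>+u. G u \<partial>lborel)"
    unfolding G_def by (subst lborel.nn_integral_fst) (auto simp: lborel_prod)
  also have "\<dots> = (\<integral>\<^sup>+x\<in>{0..pi/2}. G ((sin x)\<^sup>2) * ennreal (2 * sin x * cos x) \<partial>lborel)"
  proof (rule nn_integral_sin_substitution)
    fix u :: real
    assume "u \<notin> {(sin 0)\<^sup>2..1}"
    hence "J (u, v) = 0" for v
      by (auto simp: J_def Y_domain_def indicator_def)
    thus "G u = 0" by (simp add: G_def)
  qed auto
  also have "\<dots> = (\<integral>\<^sup>+x\<in>{0..pi/2}. ennreal (4 * (phi 0 h x * Phi 0 h (pi/2 - x))) \<partial>lborel)"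
  proof (rule nn_integral_cong_AE)
    have "AE x in lborel. x \<noteq> 0 \<and> x \<noteq> pi/2"
      using AE_lborel_singleton[of 0] AE_lborel_singleton[of "pi/2"] by eventually_elim simp
    thus "AE x in lborel. G ((sin x)\<^sup>2) * ennreal (2 * sin x * cos x) * indicator {0..pi/2} x
        = ennreal (4 * (phi 0 h x * Phi 0 h (pi/2 - x))) * indicator {0..pi/2} x"
      by eventually_elim (use G_eq in \<open>auto simp: indicator_def\<close>)
  qed
  also have "\<dots> = ennreal (4 * pairing 0 0 h)"
  proof (rule nn_integral_has_integral_lebesgue')
    show "0 \<le> 4 * (phi 0 h x * Phi 0 h (pi/2 - x))" for x
      using Phi_nonneg ell_pos[OF h, of x] by (simp add: phi_simps)
    show "((\<lambda>x. 4 * (phi 0 h x * Phi 0 h (pi/2 - x))) has_integral 4 * pairing 0 0 h) {0..pi/2}"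
      unfolding pairing_def
      by (intro has_integral_mult_right integrable_integral pairing_integrable h)
  qed
  \<comment> \<open>The value is finite, so the Lebesgue integral defining \<open>Y h\<close> is a
    genuine one and not the default 0.\<close>
  finally have "(\<integral>\<^sup>+p. ennreal (J p) \<partial>lborel) = ennreal (4 * pairing 0 0 h)" .
  moreover have "0 \<le> pairing 0 0 h"
    unfolding pairing_def using Phi_nonneg ell_pos[OF h]
    by (intro integral_nonneg pairing_integrable[OF h]) (auto simp: phi_simps less_imp_le)
  moreover have "Y h = (LINT p|lborel. J p)"
    by (simp add: Y_def set_lebesgue_integral_def J_def)
  ultimately show ?thesis
    using J_nonneg by (subst (asm) integral_eq_nn_integral) auto
qed

section \<open>Differential equation for \<open>Y\<close>\<close>

lemma DERIV_transform_unit_interval: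
  assumes "\<bar>h\<bar> < 1" "\<And>h::real. \<bar>h\<bar> < 1 \<Longrightarrow> f h = g h" "(g has_real_derivative d) (at h)"
  shows "(f has_real_derivative d) (at h)"
  by (rule has_field_derivative_transform_within_open[OF assms(3), of "{-1<..<1}"])
     (use assms(1,2) in auto)

text \<open>The operators are expanded: \<open>(2\<theta> + 1)(2\<theta>^2 + 2\<theta> + 1) =
  4\<theta>^3 + 6\<theta>^2 + 4\<theta> + 1\<close>, and likewise the cube. Since
  \<open>deriv\<close> is total, the differentiability claims ensure that each \<open>theta\<close>
  is a true derivative.\<close>

theorem theorem2:
  shows "\<exists>\<epsilon>>0. \<forall>h::real. \<bar>h\<bar> < \<epsilon> \<longrightarrow>
     Y differentiable (at h) \<and> theta Y differentiable (at h) \<and>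
     theta (theta Y) differentiable (at h) \<and>
     theta (theta (theta Y)) h
       - (1/2) * h * (4 * theta (theta (theta Y)) h + 6 * theta (theta Y) h + 4 * theta Y h + Y h)
       + h^2 * (theta (theta (theta Y)) h + 3 * theta (theta Y) h + 3 * theta Y h + Y h)
     = - ((4 - 4*h - h^2) * h) / ((2 - h)^2 * sqrt (1 - h))"
proof (intro exI[of _ 1] conjI allI impI)
  \<comment> \<open>The first three derivatives of \<open>Y\<close>, with terms merged by the
    symmetry of the pairing.\<close>
  define Y1 where "Y1 h = 8 * pairing 0 1 h" for h
  define Y2 where "Y2 h = 8 * (pairing 1 1 h + pairing 0 2 h)" for h
  define Y3 where "Y3 h = 8 * (3 * pairing 1 2 h + pairing 0 3 h)" for h
  have D0: "(Y has_real_derivative Y1 h) (at h)" if "\<bar>h\<bar> < 1" for h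
  proof (rule DERIV_transform_unit_interval[OF that Y_eq_pairing])
    show "((\<lambda>h. 4 * pairing 0 0 h) has_real_derivative Y1 h) (at h)"
      by (rule DERIV_cong[OF DERIV_cmult[OF DERIV_pairing[OF that]]])
         (simp add: Y1_def pairing_commute[OF that, of "Suc 0" 0])
  qed
  have D1: "(Y1 has_real_derivative Y2 h) (at h)" if "\<bar>h\<bar> < 1" for h
    unfolding Y1_def[abs_def]
    by (rule DERIV_cong[OF DERIV_cmult[OF DERIV_pairing[OF that]]])
       (simp add: Y2_def numeral_2_eq_2)
  have D2: "(Y2 has_real_derivative Y3 h) (at h)" if "\<bar>h\<bar> < 1" for h
    unfolding Y2_def[abs_def]
    by (rule DERIV_cong[OF DERIV_cmult[OF DERIV_add[OF DERIV_pairing[OF that] DERIV_pairing[OF that]]]])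
       (simp add: Y3_def numeral_2_eq_2 numeral_3_eq_3 pairing_commute[OF that, of "Suc (Suc 0)" "Suc 0"])
  have th1: "theta Y h = h * Y1 h" if "\<bar>h\<bar> < 1" for h
    using DERIV_imp_deriv[OF D0[OF that]] by (simp add: theta_def)
  have E1: "(theta Y has_real_derivative Y1 h + h * Y2 h) (at h)" if "\<bar>h\<bar> < 1" for h
    by (rule DERIV_transform_unit_interval[OF that th1])
       (auto intro!: derivative_eq_intros D1 that)
  have th2: "theta (theta Y) h = h * (Y1 h + h * Y2 h)" if "\<bar>h\<bar> < 1" for h
    using DERIV_imp_deriv[OF E1[OF that]] by (simp add: theta_def[of "theta Y"])
  have E2: "(theta (theta Y) has_real_derivative Y1 h + 3 * h * Y2 h + h\<^sup>2 * Y3 h) (at h)"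
    if "\<bar>h\<bar> < 1" for h
    by (rule DERIV_transform_unit_interval[OF that th2])
       (auto intro!: derivative_eq_intros D1 D2 that simp: algebra_simps power2_eq_square)
  have th3: "theta (theta (theta Y)) h = h * (Y1 h + 3 * h * Y2 h + h\<^sup>2 * Y3 h)" if "\<bar>h\<bar> < 1" for h
    using DERIV_imp_deriv[OF E2[OF that]] by (simp add: theta_def[of "theta (theta Y)"])
  fix h :: real
  assume h: "\<bar>h\<bar> < 1"
  show "Y differentiable (at h)" "theta Y differentiable (at h)" "theta (theta Y) differentiable (at h)"
    using D0[OF h] E1[OF h] E2[OF h] real_differentiable_def by blast+
  show "theta (theta (theta Y)) h
       - (1/2) * h * (4 * theta (theta (theta Y)) h + 6 * theta (theta Y) h + 4 * theta Y h + Y h)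
       + h^2 * (theta (theta (theta Y)) h + 3 * theta (theta Y) h + 3 * theta Y h + Y h)
     = - ((4 - 4*h - h^2) * h) / ((2 - h)^2 * sqrt (1 - h))" (is "?L = ?R")
  proof (cases "h = 0")
    \<comment> \<open>Every summand on the left carries a factor \<open>h\<close>, so both sides are
      0; the boundary integrals are available only for \<open>h \<noteq> 0\<close>.\<close>
    case True
    thus ?thesis by (simp add: th3)
  next
    case False
    define z where "z = 1 / sqrt (1 - h)"
    note ode = pairing_ode[OF h False, folded z_def]
    \<comment> \<open>The first two multipliers are forced by the coefficients of
      \<open>pairing 1 2\<close> and \<open>pairing 0 3\<close>, the third by what is left of
      \<open>pairing 0 2\<close>. That all other coefficients then match is the symmetric-square
      property.\<close>
    have "?L = 24 * h\<^sup>2 * (1 - h) *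
          (h * (1 - h) * pairing 1 2 h + (1 - 2*h) * pairing 1 1 h + (-1/4) * pairing 1 0 h)
        + 8 * h\<^sup>2 * (1 - h) *
          (h * (1 - h) * pairing 0 3 h + 2 * (1 - 2*h) * pairing 0 2 h + (-9/4) * pairing 0 1 h)
        + 8 * h * (1 - 2*h) *
          (h * (1 - h) * pairing 0 2 h + (1 - 2*h) * pairing 0 1 h + (-1/4) * pairing 0 0 h)"
      unfolding th1[OF h] th2[OF h] th3[OF h] Y_eq_pairing[OF h] Y1_def Y2_def Y3_def
        pairing_commute[OF h, of 1 0]
      by algebra
    also have "\<dots> = 24 * h\<^sup>2 * (1 - h) * (- (1/8) * (z / (2 - h)\<^sup>2))
        + 8 * h\<^sup>2 * (1 - h) * (- (3/8) * ((3 - 2*h) / (1 - h) * z / (3 * (2 - h)\<^sup>2)))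
        + 8 * h * (1 - 2*h) * (- (1/4) * (z / (2 - h)))"
      unfolding ode ..
    also have "\<dots> = - ((4 - 4*h - h\<^sup>2) * h) * z / (2 - h)\<^sup>2"
    proof -
      have "1 - h \<noteq> 0" "2 - h \<noteq> 0" using h by auto
      hence "8 * h\<^sup>2 * (1 - h) * (- (3/8) * ((3 - 2*h) / (1 - h) * z / (3 * (2 - h)\<^sup>2)))
          = - (h\<^sup>2 * (3 - 2*h) * z) / (2 - h)\<^sup>2"
        and "24 * h\<^sup>2 * (1 - h) * (- (1/8) * (z / (2 - h)\<^sup>2)) = - (3 * h\<^sup>2 * (1 - h) * z) / (2 - h)\<^sup>2"
        by simp_all
      \<comment> \<open>Stated for a general \<open>m\<close> so that the denominator
        \<open>2 - h\<close> is not expanded.\<close>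
      moreover have "8 * h * (1 - 2*h) * (- (1/4) * (z / m)) = - (2 * h * (1 - 2*h) * m * z) / m\<^sup>2"
        if "m \<noteq> 0" for m
        using that by (simp add: field_simps power2_eq_square)
      note this[OF \<open>2 - h \<noteq> 0\<close>]
      moreover have "- (3 * h\<^sup>2 * (1 - h) * z) + - (h\<^sup>2 * (3 - 2*h) * z) + - (2 * h * (1 - 2*h) * (2 - h) * z)
          = - ((4 - 4*h - h\<^sup>2) * h) * z"
        by algebra
      ultimately show ?thesis
        by (simp only: add_divide_distrib[symmetric])
    qed
    also have "\<dots> = ?R"
      by (simp add: z_def)
    finally show ?thesis .
  qed
qed auto

end
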